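(* Let $\psi$ and $\varphi$ be analytic functions on the open unit disk $\mathbb{D}$ with $\varphi(\mathbb{D})\subseteq\mathbb{D}$, and let $X$ be a set of analytic functions on $\mathbb{D}$ that is automorphism invariant. (a) Suppose that (i) $f\circ\varphi\in X$ whenever $f\in X$; (ii) $X$ contains a univalent function; (iii) $X$ contains a nonconstant function that is analytic on a neighborhood of the closed disk $\overline{\mathbb{D}}$; and (iv) there is a dense subset $S$ of the unit circle $\partial\mathbb{D}$ such that for each point in $S$ there is a function in $X$ that does not extend analytically to a neighborhood of that point. Then $C_\varphi:X\to X$, $C_\varphi f=f\circ\varphi$, is invertible on $X$ if and only if $\varphi$ is an automorphism of $\mathbb{D}$. (b) Suppose that (i) $W_{\psi,\varphi}f:=\psi\cdot(f\circ\varphi)$ belongs to $X$ whenever $f\in X$; (ii) $X$ contains a nonzero constant function; (iii) $X$ contains a function of the form $z\mapsto z+c$ for some constant $c\in\mathbb{C}$; and (iv) there is a dense subset $S$ of $\partial\mathbb{D}$ such that for each point in $S$ there is a function in $X$ that does not extend analytically to a neighborhood of that point. Then $W_{\psi,\varphi}:X\to X$ is invertible on $X$ if and only if $\varphi$ is an automorphism of $\mathbb{D}$ and both $\psi$ and $1/\psi$ are multipliers of $X$.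
   Context: $\mathbb{D}=\{z\in\mathbb{C}:|z|<1\}$. The set $X$ is only a set of analytic functions on $\mathbb{D}$; it is not assumed to have any linear or norm structure. "Invertible on $X$" means that the map from $X$ to $X$ is a bijection. "Univalent" means analytic and injective on $\mathbb{D}$. In (a)(iii), the function is an element of $X$ that has an analytic extension to an open set containing $\overline{\mathbb{D}}$. A function $f$ analytic on $\mathbb{D}$ extends analytically to a neighborhood of $\zeta\in\partial\mathbb{D}$ if there are an open disk $U$ centered at $\zeta$ and an analytic function on $\mathbb{D}\cup U$ that agrees with $f$ on $\mathbb{D}$. An automorphism of $\mathbb{D}$ is an analytic bijection of $\mathbb{D}$ onto $\mathbb{D}$. The set $X$ is automorphism invariant if $f\circ\tau\in X$ whenever $f\in X$ and $\tau$ is an automorphism of $\mathbb{D}$. A function $g$ on $\mathbb{D}$ is a multiplier of $X$ if $gf\in X$ whenever $f\in X$; saying that $1/\psi$ is a multiplier includes that $\psi$ has no zeros in $\mathbb{D}$, so that $1/\psi$ is a function on $\mathbb{D}$. *)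

theory Defs
  imports "HOL-Complex_Analysis.Complex_Analysis" "HOL-Library.FuncSet"
begin

abbreviation unit_disk :: "complex set" (\<open>\<D>\<close>) where
  "\<D> \<equiv> ball 0 1"

text \<open>
  A function whose domain is the disk is represented by the total function that agrees with it
  on the disk and takes the fixed value \<^term>\<open>undefined\<close> elsewhere (\<^const>\<open>extensional\<close>).
  Thus HOL equality of members of \<open>disk_analytic\<close> is equality of functions on the disk, and the
  operators below return representatives of the same kind.
\<close>

definition disk_analytic :: "(complex \<Rightarrow> complex) set" where
  "disk_analytic = {f \<in> extensional \<D>. f analytic_on \<D>}"

definition weighted_comp_op ::
    "(complex \<Rightarrow> complex) \<Rightarrow> (complex \<Rightarrow> complex) \<Rightarrow> (complex \<Rightarrow> complex) \<Rightarrow> complex \<Rightarrow> complex" where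
  "weighted_comp_op \<psi> \<phi> f = (\<lambda>z\<in>\<D>. \<psi> z * f (\<phi> z))"

definition comp_op :: "(complex \<Rightarrow> complex) \<Rightarrow> (complex \<Rightarrow> complex) \<Rightarrow> complex \<Rightarrow> complex" where
  "comp_op \<phi> f = (\<lambda>z\<in>\<D>. f (\<phi> z))"

definition disk_automorphism :: "(complex \<Rightarrow> complex) \<Rightarrow> bool" where
  "disk_automorphism \<tau> \<longleftrightarrow> \<tau> analytic_on \<D> \<and> bij_betw \<tau> \<D> \<D>"

definition automorphism_invariant :: "(complex \<Rightarrow> complex) set \<Rightarrow> bool" where
  "automorphism_invariant X \<longleftrightarrow>
     (\<forall>f\<in>X. \<forall>\<tau>. disk_automorphism \<tau> \<longrightarrow> comp_op \<tau> f \<in> X)"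

definition invertible_on ::
    "((complex \<Rightarrow> complex) \<Rightarrow> complex \<Rightarrow> complex) \<Rightarrow> (complex \<Rightarrow> complex) set \<Rightarrow> bool" where
  "invertible_on T X \<longleftrightarrow> bij_betw T X X"

definition univalent :: "(complex \<Rightarrow> complex) \<Rightarrow> bool" where
  "univalent f \<longleftrightarrow> f analytic_on \<D> \<and> inj_on f \<D>"

definition multiplier :: "(complex \<Rightarrow> complex) set \<Rightarrow> (complex \<Rightarrow> complex) \<Rightarrow> bool" where
  "multiplier X g \<longleftrightarrow> (\<forall>f\<in>X. (\<lambda>z\<in>\<D>. g z * f z) \<in> X)"

text \<open>
  The convention \<open>1 / 0 = 0\<close> would turn the reciprocal into a function on the whole disk even
  if the weight had zeros there, so their absence is required explicitly.
\<close>

definition reciprocal_multiplier :: "(complex \<Rightarrow> complex) set \<Rightarrow> (complex \<Rightarrow> complex) \<Rightarrow> bool" where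
  "reciprocal_multiplier X \<psi> \<longleftrightarrow>
     (\<forall>z\<in>\<D>. \<psi> z \<noteq> 0) \<and> multiplier X (\<lambda>z. 1 / \<psi> z)"

definition extends_past_closed_disk :: "(complex \<Rightarrow> complex) \<Rightarrow> bool" where
  "extends_past_closed_disk f \<longleftrightarrow>
     (\<exists>V F. open V \<and> cball 0 1 \<subseteq> V \<and> F analytic_on V \<and> (\<forall>z\<in>\<D>. F z = f z))"

definition extends_analytically_at :: "(complex \<Rightarrow> complex) \<Rightarrow> complex \<Rightarrow> bool" where
  "extends_analytically_at f \<zeta> \<longleftrightarrow>
     (\<exists>r>0. \<exists>F. F analytic_on (\<D> \<union> ball \<zeta> r) \<and> (\<forall>z\<in>\<D>. F z = f z))"

definition densely_nonextendable :: "(complex \<Rightarrow> complex) set \<Rightarrow> bool" where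
  "densely_nonextendable X \<longleftrightarrow>
     (\<exists>S. S \<subseteq> sphere 0 1 \<and> sphere 0 1 \<subseteq> closure S \<and>
          (\<forall>\<zeta>\<in>S. \<exists>f\<in>X. \<not> extends_analytically_at f \<zeta>))"

end

theory Submission
  imports Defs
begin

text \<open>
  Only the passage from invertibility to \<open>\<phi>\<close> being an automorphism has analytic content; the
  converse directions are formal, because composition with an automorphism permutes \<open>X\<close> and
  \<open>W\<^bsub>\<psi>,\<phi>\<^esub>\<close> is \<open>C\<^bsub>\<phi>\<^esub>\<close> followed by multiplication by \<open>\<psi>\<close>.

  Surjectivity of the operator drives that passage. Writing the distinguished members of \<open>X\<close>
  as images of the operator shows that \<open>\<phi>\<close> is injective, and produces a nonconstant function
  \<open>h\<close>, holomorphic on \<open>\<D>\<close> or on \<open>\<D>\<close> minus a discrete set disjoint from the range of \<open>\<phi>\<close>,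
  such that \<open>h \<circ> \<phi>\<close> is the restriction of a function \<open>F\<close> holomorphic near the closed disk.
  Without a weight, \<open>h\<close> is the preimage of the member that continues past the closed disk. With
  a weight, \<open>F\<close> is the identity, and \<open>h\<close>, obtained from the quotient of the preimages of
  \<open>z + b\<close> and \<open>c\<close>, continues \<open>\<phi>\<inverse>\<close> meromorphically to \<open>\<D>\<close>.

  Suppose that \<open>\<phi>\<close> is not onto \<open>\<D>\<close>. Then the range of \<open>\<phi>\<close> has a frontier point \<open>w\<close> inside
  \<open>\<D>\<close>. The frontier of an injective image of the disk has no isolated points
  (\<open>frontier_injective_image_islimpt\<close>), so \<open>w\<close> can be moved off the singularities of \<open>h\<close>
  and the zeros of its derivative. If \<open>\<phi> z\<^sub>n \<rightarrow> w\<close>, then \<open>z\<^sub>n\<close> accumulates at some \<open>\<zeta>\<close> on the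
  circle, and a local inverse of \<open>h\<close> at \<open>w\<close> composed with \<open>F\<close> continues \<open>\<phi>\<close> across \<open>\<zeta>\<close>
  with values inside \<open>\<D>\<close> (\<open>holomorphic_extension_at_frontier_value\<close>). Hence every function in
  the range of the operator, that is every member of \<open>X\<close>, continues across the same arc around
  \<open>\<zeta>\<close>; this contradicts the dense set of nonextendability points.
\<close>

section \<open>Boundary behaviour of injective self-maps of the disk\<close>

text \<open>
  Near an isolated frontier point \<open>w\<close> the image would fill a punctured disk. There the inverse
  map is bounded, hence extends holomorphically to \<open>w\<close>, with a value in the open disk by the
  open mapping theorem; continuity of \<open>\<phi>\<close> then makes \<open>w\<close> a value of \<open>\<phi>\<close>, although the image
  is open.
\<close>

lemma frontier_injective_image_islimpt:
  fixes \<phi> :: "complex \<Rightarrow> complex"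
  assumes holo: "\<phi> holomorphic_on \<D>" and inj: "inj_on \<phi> \<D>"
    and w: "w \<in> frontier (\<phi> ` \<D>)"
  shows "w islimpt frontier (\<phi> ` \<D>)"
proof (rule ccontr)
  assume "\<not> w islimpt frontier (\<phi> ` \<D>)"
  then obtain T where T: "w \<in> T" "open T" "\<And>y. y \<in> frontier (\<phi> ` \<D>) \<Longrightarrow> y \<in> T \<Longrightarrow> y = w"
    unfolding islimpt_def by blast
  then obtain r where r: "r > 0" "ball w r \<subseteq> T"
    using open_contains_ball by blast
  have op: "open (\<phi> ` \<D>)"
    using open_mapping_thm3[OF holo _ inj] by simp
  have wn: "w \<notin> \<phi> ` \<D>"
    using w op by (simp add: frontier_def interior_open)
  \<comment> \<open>The punctured ball is connected, meets the image and avoids its frontier.\<close>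
  have punct: "ball w r - {w} \<subseteq> \<phi> ` \<D>"
  proof (rule ccontr)
    assume "\<not> ball w r - {w} \<subseteq> \<phi> ` \<D>"
    then have "(ball w r - {w}) - \<phi> ` \<D> \<noteq> {}" by blast
    moreover have "w \<in> closure (\<phi> ` \<D>)"
      using w by (simp add: frontier_def)
    then obtain y where "y \<in> \<phi> ` \<D>" "dist y w < r"
      using r(1) closure_approachable by blast
    with wn have "(ball w r - {w}) \<inter> \<phi> ` \<D> \<noteq> {}"
      by (force simp: dist_commute)
    moreover have "connected (ball w r - {w})"
      by (rule connected_punctured_ball) simp
    ultimately have "(ball w r - {w}) \<inter> frontier (\<phi> ` \<D>) \<noteq> {}"
      using connected_Int_frontier by blast
    with T(3) r(2) show False by blast
  qed
  obtain k where k: "k holomorphic_on \<phi> ` \<D>" "\<And>z. z \<in> \<D> \<Longrightarrow> k (\<phi> z) = z"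
    using holomorphic_has_inverse[OF holo open_ball inj] by metis
  have kD: "k v \<in> \<D>" "\<phi> (k v) = v" if "v \<in> ball w r - {w}" for v
    using punct that k(2) by force+
  have "\<forall>\<^sub>F v in at w. cmod (k v) \<le> 1"
    unfolding eventually_at using r(1) kD(1)
    by (intro exI[of _ r]) (force simp: dist_commute)
  then obtain K where K: "K holomorphic_on ball w r" "\<And>v. v \<in> ball w r - {w} \<Longrightarrow> K v = k v"
    using holomorphic_on_extend_bounded[of k "ball w r" w] holomorphic_on_subset[OF k(1) punct] r(1)
    by auto
  have contK: "isCont K v" if "v \<in> ball w r" for v
    using K(1) that holomorphic_on_imp_continuous_on continuous_on_eq_continuous_at open_ball by blast
  have Kw: "K \<midarrow>w\<rightarrow> K w"
    using contK[of w] r(1) by (simp add: isCont_def)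
  have ev: "\<forall>\<^sub>F v in at w. v \<in> ball w r - {w}"
    using r(1) by (intro eventually_at_in_open) auto
  have le: "cmod (K v) \<le> 1" if "v \<in> ball w r" for v
  proof (cases "v = w")
    case True
    have "cmod (K w) \<le> 1"
    proof (rule Lim_norm_ubound[OF _ Kw])
      show "\<forall>\<^sub>F v in at w. cmod (K v) \<le> 1"
        using ev by (rule eventually_mono) (use K(2) kD(1) in force)
    qed simp
    with True show ?thesis by simp
  next
    case False
    with that kD(1)[of v] K(2)[of v] show ?thesis by auto
  qed
  \<comment> \<open>The bound \<open>\<bar>K\<bar> \<le> 1\<close> obtained in the limit is strict, because \<open>K\<close> is an open map.\<close>
  have "\<not> K constant_on ball w r"
  proof
    assume "K constant_on ball w r"
    then obtain c where c: "\<And>v. v \<in> ball w r \<Longrightarrow> K v = c"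
      unfolding constant_on_def by blast
    have *: "v = \<phi> c" if "v \<in> ball w r - {w}" for v
      using kD(2)[OF that] K(2)[OF that] c[of v] that by auto
    have "w + of_real (r/2) \<in> ball w r - {w}" "w + of_real (r/3) \<in> ball w r - {w}"
      using r(1) by (auto simp: dist_norm)
    from *[OF this(1)] *[OF this(2)] have "complex_of_real (r/2) = of_real (r/3)"
      by (metis add_left_cancel)
    with r(1) show False
      unfolding of_real_eq_iff by simp
  qed
  then have "open (K ` ball w r)"
    using open_mapping_thm[OF K(1)] by blast
  moreover have "K ` ball w r \<subseteq> cball 0 1"
    using le by auto
  ultimately have "K ` ball w r \<subseteq> \<D>"
    using interior_maximal[of "K ` ball w r" "cball 0 1"] by (simp only: interior_cball)
  then have "K w \<in> \<D>"
    using r(1) by (meson centre_in_ball image_subset_iff)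
  \<comment> \<open>The identity \<open>\<phi> (K v) = v\<close> passes to the limit \<open>v \<rightarrow> w\<close>.\<close>
  then have "isCont \<phi> (K w)"
    using holo holomorphic_on_imp_continuous_on continuous_on_eq_continuous_at open_ball by blast
  then have "(\<lambda>v. \<phi> (K v)) \<midarrow>w\<rightarrow> \<phi> (K w)"
    using Kw isCont_tendsto_compose by blast
  moreover have "(\<lambda>v. \<phi> (K v)) \<midarrow>w\<rightarrow> w"
  proof (rule Lim_transform_eventually[OF tendsto_ident_at])
    show "\<forall>\<^sub>F v in at w. v = \<phi> (K v)"
      using ev by (rule eventually_mono) (simp only: K(2) kD(2))
  qed
  ultimately have "\<phi> (K w) = w"
    using LIM_unique by blast
  with \<open>K w \<in> \<D>\<close> wn show False by force
qed

text \<open>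
  The point \<open>\<zeta>\<close> is an accumulation point of preimages of values tending to \<open>w\<close>, and then
  \<open>h w = F \<zeta>\<close> by continuity. With \<open>k\<close> a local inverse of \<open>h\<close> at \<open>w\<close>, the extension is
  \<open>k \<circ> F\<close>. It takes values near \<open>w\<close>, in particular in \<open>U\<close>, and this is what makes \<open>f \<circ> \<phi>\<close>
  extend for every \<open>f\<close> holomorphic on \<open>U\<close>.
\<close>

lemma holomorphic_extension_at_frontier_value:
  fixes \<phi> h F :: "complex \<Rightarrow> complex"
  assumes holo: "\<phi> holomorphic_on \<D>" and opn: "open (\<phi> ` \<D>)"
    and U: "open U" "\<phi> ` \<D> \<subseteq> U" and h: "h holomorphic_on U"
    and V: "open V" "cball 0 1 \<subseteq> V" and F: "F holomorphic_on V"
    and eq: "\<And>z. z \<in> \<D> \<Longrightarrow> h (\<phi> z) = F z"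
    and w: "w \<in> frontier (\<phi> ` \<D>)" "w \<in> U" "deriv h w \<noteq> 0"
  obtains \<zeta> r \<Phi> where "\<zeta> \<in> sphere 0 1" "r > 0" "\<Phi> holomorphic_on ball \<zeta> r"
    "\<Phi> ` ball \<zeta> r \<subseteq> U" "\<And>z. z \<in> \<D> \<inter> ball \<zeta> r \<Longrightarrow> \<Phi> z = \<phi> z"
proof -
  have wn: "w \<notin> \<phi> ` \<D>"
    using w(1) opn by (simp add: frontier_def interior_open)
  have "w \<in> closure (\<phi> ` \<D>)"
    using w(1) by (simp add: frontier_def)
  then obtain y where y: "\<And>n. y n \<in> \<phi> ` \<D>" "y \<longlonglongrightarrow> w"
    using closure_sequential by blast
  then have "\<forall>n. \<exists>x. x \<in> \<D> \<and> y n = \<phi> x" by blast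
  then obtain x where x: "\<And>n. x n \<in> \<D>" "\<And>n. y n = \<phi> (x n)" by metis
  have "\<forall>n. x n \<in> cball 0 1"
    using x(1) ball_subset_cball by blast
  then obtain \<zeta> s where \<zeta>: "\<zeta> \<in> cball 0 1" "strict_mono s" "(x \<circ> s) \<longlonglongrightarrow> \<zeta>"
    using compact_cball[of "0::complex" 1] unfolding compact_def by blast
  define u where "u = x \<circ> s"
  have u: "\<And>n. u n \<in> \<D>" "u \<longlonglongrightarrow> \<zeta>"
    using x(1) \<zeta>(3) by (auto simp: u_def)
  have \<phi>u: "(\<lambda>n. \<phi> (u n)) \<longlonglongrightarrow> w"
    using LIMSEQ_subseq_LIMSEQ[OF y(2) \<zeta>(2)] x(2) by (simp add: u_def o_def)
  have "\<zeta> \<notin> \<D>"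
  proof
    assume "\<zeta> \<in> \<D>"
    then have "isCont \<phi> \<zeta>"
      using holo holomorphic_on_imp_continuous_on continuous_on_eq_continuous_at open_ball by blast
    then have "(\<lambda>n. \<phi> (u n)) \<longlonglongrightarrow> \<phi> \<zeta>"
      using u(2) isCont_tendsto_compose by blast
    with \<phi>u have "w = \<phi> \<zeta>"
      using LIMSEQ_unique by blast
    with wn \<open>\<zeta> \<in> \<D>\<close> show False by blast
  qed
  with \<zeta>(1) have \<zeta>s: "\<zeta> \<in> sphere 0 1" by auto
  have "isCont h w"
    using h w(2) U(1) holomorphic_on_imp_continuous_on continuous_on_eq_continuous_at by blast
  then have "(\<lambda>n. h (\<phi> (u n))) \<longlonglongrightarrow> h w"
    using \<phi>u isCont_tendsto_compose by blast
  moreover have "isCont F \<zeta>"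
    using F \<zeta>(1) V holomorphic_on_imp_continuous_on continuous_on_eq_continuous_at by blast
  then have "(\<lambda>n. F (u n)) \<longlonglongrightarrow> F \<zeta>"
    using u(2) isCont_tendsto_compose by blast
  ultimately have hwF: "h w = F \<zeta>"
    using LIMSEQ_unique eq u(1) by auto
  obtain \<rho> where \<rho>: "\<rho> > 0" "ball w \<rho> \<subseteq> U" "open (h ` ball w \<rho>)" "inj_on h (ball w \<rho>)"
    using has_complex_derivative_locally_invertible[OF h w(2) U(1) w(3)] by blast
  obtain k where k: "k holomorphic_on h ` ball w \<rho>" "\<And>v. v \<in> ball w \<rho> \<Longrightarrow> k (h v) = v"
    using holomorphic_has_inverse[OF holomorphic_on_subset[OF h \<rho>(2)] open_ball \<rho>(4)] by metis
  have "open (V \<inter> F -` (h ` ball w \<rho>))"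
    using continuous_open_preimage[OF holomorphic_on_imp_continuous_on[OF F] V(1) \<rho>(3)] .
  moreover have "\<zeta> \<in> V \<inter> F -` (h ` ball w \<rho>)"
    using \<zeta>(1) V(2) hwF \<rho>(1) by (auto intro!: image_eqI[of _ h w])
  ultimately obtain r where r: "r > 0" "ball \<zeta> r \<subseteq> V \<inter> F -` (h ` ball w \<rho>)"
    using open_contains_ball by blast
  have \<Phi>: "(k \<circ> F) holomorphic_on ball \<zeta> r"
    by (rule holomorphic_on_compose_gen[OF holomorphic_on_subset[OF F] k(1)]) (use r(2) in auto)
  have im: "(k \<circ> F) ` ball \<zeta> r \<subseteq> U"
    using r(2) k(2) \<rho>(2) by fastforce
  \<comment> \<open>The equation \<open>k (h v) = v\<close> is available only for \<open>v\<close> near \<open>w\<close>, and \<open>\<phi>\<close> may leave that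
    neighbourhood within \<open>W\<close>; so agreement is first obtained on \<open>N\<close>, which contains late terms
    of the sequence, and spreads to \<open>W\<close> by the identity theorem.\<close>
  define W where "W = \<D> \<inter> ball \<zeta> r"
  have W: "open W" "connected W" "W \<subseteq> \<D>" "W \<subseteq> ball \<zeta> r"
    unfolding W_def by (auto intro!: convex_connected convex_Int)
  define N where "N = W \<inter> \<phi> -` ball w \<rho>"
  have oN: "open N"
    unfolding N_def using holomorphic_on_imp_continuous_on[OF holomorphic_on_subset[OF holo W(3)]] W(1)
    by (intro continuous_open_preimage) auto
  have "\<forall>\<^sub>F n in sequentially. u n \<in> ball \<zeta> r"
    using topological_tendstoD[OF u(2) open_ball] r(1) by simp
  moreover have "\<forall>\<^sub>F n in sequentially. \<phi> (u n) \<in> ball w \<rho>"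
    using topological_tendstoD[OF \<phi>u open_ball] \<rho>(1) by simp
  ultimately have "\<forall>\<^sub>F n in sequentially. u n \<in> N"
    by eventually_elim (use u(1) in \<open>auto simp: N_def W_def\<close>)
  then have "N \<noteq> {}"
    using eventually_happens trivial_limit_sequentially by blast
  have "(k \<circ> F) z = \<phi> z" if "z \<in> W" for z
  proof (rule analytic_continuation_open[where f = "k \<circ> F" and g = \<phi>, OF oN W(1) \<open>N \<noteq> {}\<close> W(2)])
    show "N \<subseteq> W" by (auto simp: N_def)
    show "(k \<circ> F) holomorphic_on W" using \<Phi> W(4) holomorphic_on_subset by blast
    show "\<phi> holomorphic_on W" using holo W(3) holomorphic_on_subset by blast
    show "(k \<circ> F) v = \<phi> v" if "v \<in> N" for v
      using that eq[of v] k(2)[of "\<phi> v"] by (auto simp: N_def W_def)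
    show "z \<in> W" by fact
  qed
  with that[OF \<zeta>s r(1) \<Phi> im] show thesis by (simp add: W_def)
qed

text \<open>
  Since the frontier of the image is perfect, a frontier point in \<open>\<D>\<close> can be chosen outside \<open>Z\<close>
  and then outside the zeros of the derivative of \<open>h\<close>. The two steps are separate because those zeros may
  accumulate at points of \<open>Z\<close>, where \<open>h\<close> may have essential singularities.
\<close>

lemma nonsurjective_symbol_extends:
  fixes \<phi> h F :: "complex \<Rightarrow> complex"
  assumes holo: "\<phi> holomorphic_on \<D>" and inj: "inj_on \<phi> \<D>"
    and proper: "\<phi> ` \<D> \<subset> \<D>"
    and Z: "Z sparse_in \<D>" "\<phi> ` \<D> \<inter> Z = {}" and h: "h holomorphic_on (\<D> - Z)"
    and V: "open V" "cball 0 1 \<subseteq> V" and F: "F holomorphic_on V"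
    and nc: "\<not> F constant_on \<D>"
    and eq: "\<And>z. z \<in> \<D> \<Longrightarrow> h (\<phi> z) = F z"
  obtains \<zeta> r \<Phi> where "\<zeta> \<in> sphere 0 1" "r > 0" "\<Phi> holomorphic_on ball \<zeta> r"
    "\<Phi> ` ball \<zeta> r \<subseteq> \<D> - Z" "\<And>z. z \<in> \<D> \<inter> ball \<zeta> r \<Longrightarrow> \<Phi> z = \<phi> z"
proof -
  define P where "P = frontier (\<phi> ` \<D>)"
  define U where "U = \<D> - Z"
  have oU: "open U"
    unfolding U_def by (intro open_diff_sparse_pts Z) simp
  have cU: "connected U"
    unfolding U_def by (intro sparse_imp_connected Z) auto
  have im: "\<phi> ` \<D> \<subseteq> U"
    using proper Z(2) by (auto simp: U_def)
  have hU: "h holomorphic_on U"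
    using h by (simp add: U_def)
  have op: "open (\<phi> ` \<D>)"
    using open_mapping_thm3[OF holo _ inj] by simp
  have perfect: "w islimpt P" if "w \<in> P" for w
    using frontier_injective_image_islimpt[OF holo inj] that by (simp add: P_def)
  have "\<D> \<inter> P \<noteq> {}"
    unfolding P_def using proper by (intro connected_Int_frontier) auto
  then obtain w0 where w0: "w0 \<in> \<D>" "w0 \<in> P" by blast
  obtain B where B: "open B" "w0 \<in> B" "\<And>y. y \<in> B \<Longrightarrow> y \<noteq> w0 \<Longrightarrow> y \<notin> Z"
    using sparse_in_not_in[OF Z(1) w0(1)] by metis
  obtain w1 where w1: "w1 \<in> P" "w1 \<in> B \<inter> \<D>" "w1 \<noteq> w0"
    using perfect[OF w0(2)] islimptE[of w0 P "B \<inter> \<D>"] B(1,2) w0(1) by auto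
  have w1U: "w1 \<in> U"
    using w1 B(3) by (auto simp: U_def)
  have dh: "deriv h holomorphic_on U"
    using hU oU by (rule holomorphic_deriv)
  have "\<exists>a\<in>U. deriv h a \<noteq> 0"
  proof (rule ccontr)
    assume "\<not> (\<exists>a\<in>U. deriv h a \<noteq> 0)"
    then have *: "deriv h v = 0" if "v \<in> U" for v using that by blast
    have "h constant_on U"
    proof -
      have "(h has_field_derivative 0) (at v)" if "v \<in> U" for v
        using holomorphic_derivI[OF hU oU that] *[OF that] by simp
      then show ?thesis
        using has_field_derivative_0_imp_constant_on oU cU by blast
    qed
    then obtain c where "\<And>v. v \<in> U \<Longrightarrow> h v = c"
      unfolding constant_on_def by blast
    then have "F z = c" if "z \<in> \<D>" for z
      using eq[OF that] im that by (metis image_subset_iff)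
    with nc show False unfolding constant_on_def by blast
  qed
  then obtain a where a: "a \<in> U" "deriv h a \<noteq> 0" by blast
  obtain w where w: "w \<in> P" "w \<in> U" "deriv h w \<noteq> 0"
  proof (cases "deriv h w1 = 0")
    case False
    with w1 w1U that show ?thesis by blast
  next
    case True
    obtain \<rho> where \<rho>: "\<rho> > 0" "ball w1 \<rho> \<subseteq> U" "\<And>z. z \<in> ball w1 \<rho> - {w1} \<Longrightarrow> deriv h z \<noteq> 0"
      using isolated_zeros[OF dh oU cU w1U True a] by blast
    obtain w2 where "w2 \<in> P" "w2 \<in> ball w1 \<rho>" "w2 \<noteq> w1"
      using perfect[OF w1(1)] islimptE[of w1 P "ball w1 \<rho>"] \<rho>(1) by auto
    with \<rho> that show ?thesis by blast
  qed
  show thesis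
    using holomorphic_extension_at_frontier_value[OF holo op oU im hU V F eq _ w(2,3)] w(1) that
    unfolding P_def U_def by blast
qed

section \<open>Surjectivity of the operator forces an automorphism\<close>

text \<open>
  An extension to a disk around any point \<open>\<zeta>\<close> of the circle restricts to a smaller disk around a
  nearby point of the dense set. Thus nonextendability, assumed only on a dense set, obstructs
  extension at every point of the circle.
\<close>

lemma densely_nonextendable_arc:
  assumes X: "X \<subseteq> disk_analytic" and nonext: "densely_nonextendable X"
    and \<zeta>: "\<zeta> \<in> sphere 0 1" and r: "r > 0"
  obtains f where "f \<in> X"
    "\<And>G. G holomorphic_on ball \<zeta> r \<Longrightarrow> \<exists>z \<in> \<D> \<inter> ball \<zeta> r. G z \<noteq> f z"
proof -
  obtain S where S: "S \<subseteq> sphere 0 1" "sphere 0 1 \<subseteq> closure S"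
    "\<And>\<xi>. \<xi> \<in> S \<Longrightarrow> \<exists>f\<in>X. \<not> extends_analytically_at f \<xi>"
    using nonext unfolding densely_nonextendable_def by blast
  obtain \<xi> where \<xi>: "\<xi> \<in> S" "dist \<xi> \<zeta> < r"
    using S(2) \<zeta> r closure_approachable by blast
  obtain f where f: "f \<in> X" "\<not> extends_analytically_at f \<xi>"
    using S(3)[OF \<xi>(1)] by blast
  have "\<exists>z \<in> \<D> \<inter> ball \<zeta> r. G z \<noteq> f z" if G: "G holomorphic_on ball \<zeta> r" for G
  proof (rule ccontr)
    assume "\<not> ?thesis"
    then have eq: "\<And>z. z \<in> \<D> \<Longrightarrow> z \<in> ball \<zeta> r \<Longrightarrow> f z = G z" by auto
    have "f holomorphic_on \<D>"
      using X f(1) by (auto simp: disk_analytic_def analytic_on_open)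
    then have hol: "(\<lambda>z. if z \<in> \<D> then f z else G z) holomorphic_on \<D> \<union> ball \<zeta> r"
      using G eq by (intro holomorphic_on_If_Un) auto
    obtain \<rho> where \<rho>: "\<rho> > 0" "ball \<xi> \<rho> \<subseteq> ball \<zeta> r"
      using \<xi>(2) open_contains_ball_eq[OF open_ball, of \<xi> \<zeta> r] by (auto simp: dist_commute)
    have "(\<lambda>z. if z \<in> \<D> then f z else G z) holomorphic_on \<D> \<union> ball \<xi> \<rho>"
      using \<rho>(2) by (intro holomorphic_on_subset[OF hol]) auto
    then have "(\<lambda>z. if z \<in> \<D> then f z else G z) analytic_on \<D> \<union> ball \<xi> \<rho>"
      by (simp add: analytic_on_open open_Un)
    then have "extends_analytically_at f \<xi>"
      unfolding extends_analytically_at_def using \<rho>(1)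
      by (intro exI[of _ \<rho>] conjI exI[of _ "\<lambda>z. if z \<in> \<D> then f z else G z"]) auto
    with f(2) show False by contradiction
  qed
  with f(1) that show thesis by blast
qed

text \<open>
  The univalent member gives injectivity of \<open>\<phi>\<close>; the member that continues past the closed disk
  factors through \<open>\<phi>\<close>, so it supplies the functions \<open>F\<close> and \<open>h\<close> of the extension lemma.
\<close>

lemma comp_op_invertible_imp_automorphism:
  assumes \<phi>: "\<phi> analytic_on \<D>" "\<phi> ` \<D> \<subseteq> \<D>" and X: "X \<subseteq> disk_analytic"
    and surj: "comp_op \<phi> ` X = X"
    and uni: "u \<in> X" "univalent u"
    and f: "f \<in> X" "\<not> f constant_on \<D>" "extends_past_closed_disk f"
    and nonext: "densely_nonextendable X"
  shows "disk_automorphism \<phi>"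
proof -
  have holo: "\<phi> holomorphic_on \<D>"
    using \<phi>(1) by (simp add: analytic_on_open)
  have fact: "\<exists>g\<in>X. \<forall>z\<in>\<D>. p z = g (\<phi> z)" if p: "p \<in> X" for p
  proof -
    obtain g where "g \<in> X" "p = comp_op \<phi> g"
      using surj p by blast
    then show ?thesis by (auto simp: comp_op_def)
  qed
  obtain g where "\<And>z. z \<in> \<D> \<Longrightarrow> u z = g (\<phi> z)"
    using fact[OF uni(1)] by blast
  then have inj: "inj_on \<phi> \<D>"
    using uni(2) unfolding univalent_def inj_on_def by metis
  have "\<phi> ` \<D> = \<D>"
  proof (rule ccontr)
    assume "\<phi> ` \<D> \<noteq> \<D>"
    with \<phi>(2) have proper: "\<phi> ` \<D> \<subset> \<D>" by blast
    obtain V F where F: "open V" "cball 0 1 \<subseteq> V" "F analytic_on V" "\<And>z. z \<in> \<D> \<Longrightarrow> F z = f z"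
      using f(3) unfolding extends_past_closed_disk_def by blast
    obtain h where h: "h \<in> X" "\<And>z. z \<in> \<D> \<Longrightarrow> f z = h (\<phi> z)"
      using fact[OF f(1)] by blast
    have hh: "h holomorphic_on \<D> - {}"
      using X h(1) by (auto simp: disk_analytic_def analytic_on_open)
    have hF: "F holomorphic_on V"
      using F(1,3) by (simp add: analytic_on_open)
    have nc: "\<not> F constant_on \<D>"
      using f(2) F(4) by (simp add: constant_on_def)
    obtain \<zeta> r \<Phi> where \<Phi>: "\<zeta> \<in> sphere 0 1" "r > 0" "\<Phi> holomorphic_on ball \<zeta> r"
      "\<Phi> ` ball \<zeta> r \<subseteq> \<D> - {}" "\<And>z. z \<in> \<D> \<inter> ball \<zeta> r \<Longrightarrow> \<Phi> z = \<phi> z"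
      using nonsurjective_symbol_extends[OF holo inj proper sparse_in_empty _ hh F(1,2) hF nc]
        h(2) F(4) by auto
    obtain p where p: "p \<in> X"
      "\<And>G. G holomorphic_on ball \<zeta> r \<Longrightarrow> \<exists>z \<in> \<D> \<inter> ball \<zeta> r. G z \<noteq> p z"
      using densely_nonextendable_arc[OF X nonext \<Phi>(1,2)] by blast
    obtain q where q: "q \<in> X" "\<And>z. z \<in> \<D> \<Longrightarrow> p z = q (\<phi> z)"
      using fact[OF p(1)] by blast
    have "q holomorphic_on \<D>"
      using X q(1) by (auto simp: disk_analytic_def analytic_on_open)
    then have "(q \<circ> \<Phi>) holomorphic_on ball \<zeta> r"
      using \<Phi>(3,4) holomorphic_on_compose_gen by blast
    from p(2)[OF this] show False
      using q(2) \<Phi>(5) by auto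
  qed
  with inj \<phi>(1) show ?thesis
    by (simp add: disk_automorphism_def bij_betw_def)
qed

text \<open>
  From \<open>c = \<psi> \<cdot> (g\<^sub>0 \<circ> \<phi>)\<close> and \<open>z + b = \<psi> \<cdot> (g\<^sub>1 \<circ> \<phi>)\<close> the weight cancels:
  \<open>h = c g\<^sub>1 / g\<^sub>0 - b\<close> is a left inverse of \<open>\<phi>\<close>, singular only at zeros of \<open>g\<^sub>0\<close>, none of which
  is a value of \<open>\<phi>\<close>. Since \<open>\<psi> = c / (g\<^sub>0 \<circ> \<phi>)\<close>, the weight continues across the circle
  wherever \<open>\<phi>\<close> does with values off those zeros.
\<close>

lemma weighted_comp_op_invertible_imp_automorphism:
  assumes \<phi>: "\<phi> analytic_on \<D>" "\<phi> ` \<D> \<subseteq> \<D>" and X: "X \<subseteq> disk_analytic"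
    and surj: "weighted_comp_op \<psi> \<phi> ` X = X"
    and const: "c \<noteq> 0" "(\<lambda>z\<in>\<D>. c) \<in> X"
    and transl: "(\<lambda>z\<in>\<D>. z + b) \<in> X"
    and nonext: "densely_nonextendable X"
  shows "disk_automorphism \<phi>" "\<And>z. z \<in> \<D> \<Longrightarrow> \<psi> z \<noteq> 0"
proof -
  have holo: "\<phi> holomorphic_on \<D>"
    using \<phi>(1) by (simp add: analytic_on_open)
  have fact: "\<exists>g\<in>X. \<forall>z\<in>\<D>. p z = \<psi> z * g (\<phi> z)" if p: "p \<in> X" for p
  proof -
    obtain g where "g \<in> X" "p = weighted_comp_op \<psi> \<phi> g"
      using surj p by blast
    then show ?thesis by (auto simp: weighted_comp_op_def)
  qed
  have holX: "g holomorphic_on \<D>" if "g \<in> X" for g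
    using X that by (auto simp: disk_analytic_def analytic_on_open)
  obtain g0 where g0: "g0 \<in> X" "\<And>z. z \<in> \<D> \<Longrightarrow> c = \<psi> z * g0 (\<phi> z)"
    using fact[OF const(2)] by auto
  obtain g1 where g1: "g1 \<in> X" "\<And>z. z \<in> \<D> \<Longrightarrow> z + b = \<psi> z * g1 (\<phi> z)"
    using fact[OF transl] by auto
  have nz: "\<psi> z \<noteq> 0" "g0 (\<phi> z) \<noteq> 0" if "z \<in> \<D>" for z
    using g0(2)[OF that] const(1) by auto
  then show "\<And>z. z \<in> \<D> \<Longrightarrow> \<psi> z \<noteq> 0" by blast
  define Z where "Z = {v \<in> \<D>. g0 v = 0}"
  define h where "h = (\<lambda>v. c * g1 v / g0 v - b)"
  have heq: "h (\<phi> z) = z" if "z \<in> \<D>" for z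
  proof -
    have "c * g1 (\<phi> z) / g0 (\<phi> z) = \<psi> z * g1 (\<phi> z)"
      using g0(2)[OF that] nz(2)[OF that] by simp
    also have "\<dots> = z + b"
      using g1(2)[OF that] by simp
    finally show ?thesis by (simp add: h_def)
  qed
  have inj: "inj_on \<phi> \<D>"
    using heq by (rule inj_on_inverseI)
  have "\<phi> ` \<D> = \<D>"
  proof (rule ccontr)
    assume "\<phi> ` \<D> \<noteq> \<D>"
    with \<phi>(2) have proper: "\<phi> ` \<D> \<subset> \<D>" by blast
    have Z: "Z sparse_in \<D>"
      unfolding sparse_in_eventually_iff[OF open_ball]
    proof
      fix v :: complex assume v: "v \<in> \<D>"
      have \<phi>0: "\<phi> 0 \<in> \<D>" "g0 (\<phi> 0) \<noteq> 0"
        using \<phi>(2) nz(2)[of 0] by (simp_all add: image_subset_iff)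
      have "\<forall>\<^sub>F y in at v. g0 y \<noteq> 0 \<and> y \<in> \<D>"
        by (rule non_zero_neighbour_alt[OF holX[OF g0(1)] _ _ v \<phi>0]) auto
      then show "\<forall>\<^sub>F y in at v. y \<notin> Z"
        by (rule eventually_mono) (auto simp: Z_def)
    qed
    have disj: "\<phi> ` \<D> \<inter> Z = {}"
      using nz(2) by (auto simp: Z_def)
    have hh: "h holomorphic_on \<D> - Z"
      unfolding h_def using holX[OF g0(1)] holX[OF g1(1)]
      by (intro holomorphic_intros) (auto simp: Z_def elim: holomorphic_on_subset)
    have nc: "\<not> (\<lambda>z. z) constant_on \<D>"
    proof
      assume "(\<lambda>z::complex. z) constant_on \<D>"
      then obtain a :: complex where "\<And>z. z \<in> \<D> \<Longrightarrow> z = a"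
        unfolding constant_on_def by blast
      from this[of 0] this[of "1 / 2"] show False by simp
    qed
    obtain \<zeta> r \<Phi> where \<Phi>: "\<zeta> \<in> sphere 0 1" "r > 0" "\<Phi> holomorphic_on ball \<zeta> r"
      "\<Phi> ` ball \<zeta> r \<subseteq> \<D> - Z" "\<And>z. z \<in> \<D> \<inter> ball \<zeta> r \<Longrightarrow> \<Phi> z = \<phi> z"
      using nonsurjective_symbol_extends[OF holo inj proper Z disj hh open_UNIV subset_UNIV
          holomorphic_on_ident nc heq] by blast
    obtain p where p: "p \<in> X"
      "\<And>G. G holomorphic_on ball \<zeta> r \<Longrightarrow> \<exists>z \<in> \<D> \<inter> ball \<zeta> r. G z \<noteq> p z"
      using densely_nonextendable_arc[OF X nonext \<Phi>(1,2)] by blast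
    obtain q where q: "q \<in> X" "\<And>z. z \<in> \<D> \<Longrightarrow> p z = \<psi> z * q (\<phi> z)"
      using fact[OF p(1)] by blast
    have "(\<lambda>v. c / g0 v * q v) holomorphic_on \<D> - Z"
      using holX[OF g0(1)] holX[OF q(1)]
      by (intro holomorphic_intros) (auto simp: Z_def elim: holomorphic_on_subset)
    then have "((\<lambda>v. c / g0 v * q v) \<circ> \<Phi>) holomorphic_on ball \<zeta> r"
      using \<Phi>(3,4) holomorphic_on_compose_gen by blast
    from p(2)[OF this] obtain z where z: "z \<in> \<D> \<inter> ball \<zeta> r"
      "c / g0 (\<Phi> z) * q (\<Phi> z) \<noteq> p z" by auto
    moreover have "c / g0 (\<phi> z) = \<psi> z"
      using z(1) g0(2)[of z] nz(2)[of z] by simp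
    ultimately show False
      using q(2)[of z] \<Phi>(5)[of z] by simp
  qed
  with inj \<phi>(1) show "disk_automorphism \<phi>"
    by (simp add: disk_automorphism_def bij_betw_def)
qed

section \<open>Operators whose symbol is an automorphism\<close>

lemma disk_automorphism_inverse:
  assumes "disk_automorphism \<tau>"
  obtains \<sigma> where "disk_automorphism \<sigma>" "\<And>z. z \<in> \<D> \<Longrightarrow> \<sigma> (\<tau> z) = z" "\<And>z. z \<in> \<D> \<Longrightarrow> \<tau> (\<sigma> z) = z"
proof -
  have \<tau>: "\<tau> holomorphic_on \<D>" "inj_on \<tau> \<D>" "\<tau> ` \<D> = \<D>"
    using assms by (auto simp: disk_automorphism_def bij_betw_def analytic_on_open)
  obtain \<sigma> where \<sigma>: "\<sigma> holomorphic_on \<D>" "\<And>z. z \<in> \<D> \<Longrightarrow> \<sigma> (\<tau> z) = z"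
    using holomorphic_has_inverse[OF \<tau>(1) open_ball \<tau>(2)] \<tau>(3) by metis
  have inv: "\<tau> (\<sigma> z) = z" "\<sigma> z \<in> \<D>" if "z \<in> \<D>" for z
    using \<tau>(3) \<sigma>(2) that by (metis imageE)+
  have "bij_betw \<sigma> \<D> \<D>"
    by (rule bij_betw_byWitness[where f' = \<tau>]) (use inv \<sigma>(2) \<tau>(3) in auto)
  with \<sigma> inv that show thesis
    by (simp add: disk_automorphism_def analytic_on_open)
qed

lemma comp_op_automorphism_bij:
  assumes X: "X \<subseteq> disk_analytic" and inv: "automorphism_invariant X"
    and \<phi>: "disk_automorphism \<phi>"
  shows "bij_betw (comp_op \<phi>) X X"
proof -
  obtain \<sigma> where \<sigma>: "disk_automorphism \<sigma>" "\<And>z. z \<in> \<D> \<Longrightarrow> \<sigma> (\<phi> z) = z" "\<And>z. z \<in> \<D> \<Longrightarrow> \<phi> (\<sigma> z) = z"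
    using disk_automorphism_inverse[OF \<phi>] by blast
  have maps: "\<And>z. z \<in> \<D> \<Longrightarrow> \<phi> z \<in> \<D>" "\<And>z. z \<in> \<D> \<Longrightarrow> \<sigma> z \<in> \<D>"
    using \<phi> \<sigma>(1) unfolding disk_automorphism_def bij_betw_def by blast+
  have clo: "comp_op \<phi> f \<in> X" "comp_op \<sigma> f \<in> X" if "f \<in> X" for f
    using inv that \<phi> \<sigma>(1) unfolding automorphism_invariant_def by blast+
  have outside: "f x = undefined" if "f \<in> X" "x \<notin> \<D>" for f x
    using X that by (auto simp: disk_analytic_def extensional_def)
  show ?thesis
  proof (rule bij_betw_byWitness[where f' = "comp_op \<sigma>"])
    show "\<forall>f\<in>X. comp_op \<sigma> (comp_op \<phi> f) = f"
      using maps \<sigma>(3) by (auto simp: comp_op_def fun_eq_iff restrict_def intro: outside[symmetric])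
    show "\<forall>f\<in>X. comp_op \<phi> (comp_op \<sigma> f) = f"
      using maps \<sigma>(2) by (auto simp: comp_op_def fun_eq_iff restrict_def intro: outside[symmetric])
  qed (use clo in auto)
qed

lemma pointwise_multiplication_bij_iff:
  assumes X: "X \<subseteq> disk_analytic" and nz: "\<And>z. z \<in> \<D> \<Longrightarrow> \<psi> z \<noteq> 0"
  shows "bij_betw (\<lambda>f. \<lambda>z\<in>\<D>. \<psi> z * f z) X X \<longleftrightarrow>
    multiplier X \<psi> \<and> multiplier X (\<lambda>z. 1 / \<psi> z)"
proof -
  define M where "M = (\<lambda>g f. \<lambda>z\<in>\<D>. g z * f z :: complex)"
  have mult: "multiplier X g \<longleftrightarrow> M g ` X \<subseteq> X" for g
    by (auto simp: multiplier_def M_def)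
  have ext: "f \<in> extensional \<D>" if "f \<in> X" for f
    using X that by (auto simp: disk_analytic_def)
  have inverse: "M (\<lambda>z. 1 / \<psi> z) (M \<psi> f) = f" "M \<psi> (M (\<lambda>z. 1 / \<psi> z) f) = f"
    if "f \<in> X" for f
    using ext[OF that] nz by (auto simp: M_def extensional_def)
  have "bij_betw (M \<psi>) X X \<longleftrightarrow> M \<psi> ` X \<subseteq> X \<and> M (\<lambda>z. 1 / \<psi> z) ` X \<subseteq> X"
  proof
    assume "bij_betw (M \<psi>) X X"
    then have im: "M \<psi> ` X = X"
      by (simp add: bij_betw_def)
    then have "M (\<lambda>z. 1 / \<psi> z) f \<in> X" if "f \<in> X" for f
      using inverse(1) that by (metis imageE)
    with im show "M \<psi> ` X \<subseteq> X \<and> M (\<lambda>z. 1 / \<psi> z) ` X \<subseteq> X" by blast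
  next
    assume "M \<psi> ` X \<subseteq> X \<and> M (\<lambda>z. 1 / \<psi> z) ` X \<subseteq> X"
    then show "bij_betw (M \<psi>) X X"
      using inverse by (intro bij_betw_byWitness[where f' = "M (\<lambda>z. 1 / \<psi> z)"]) auto
  qed
  then show ?thesis
    unfolding mult by (simp add: M_def)
qed

lemma weighted_comp_op_automorphism_bij_iff:
  assumes X: "X \<subseteq> disk_analytic" and inv: "automorphism_invariant X"
    and \<phi>: "disk_automorphism \<phi>" and nz: "\<And>z. z \<in> \<D> \<Longrightarrow> \<psi> z \<noteq> 0"
  shows "bij_betw (weighted_comp_op \<psi> \<phi>) X X \<longleftrightarrow>
    multiplier X \<psi> \<and> multiplier X (\<lambda>z. 1 / \<psi> z)"
proof -
  have eq: "weighted_comp_op \<psi> \<phi> = (\<lambda>f. \<lambda>z\<in>\<D>. \<psi> z * f z) \<circ> comp_op \<phi>"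
    by (rule ext) (simp add: weighted_comp_op_def comp_op_def cong: restrict_cong)
  show ?thesis
    unfolding eq bij_betw_comp_iff[OF comp_op_automorphism_bij[OF X inv \<phi>], symmetric]
    by (rule pointwise_multiplication_bij_iff[OF X nz])
qed

section \<open>The characterisations of invertibility\<close>

theorem corollary2p3:
  fixes \<psi> \<phi> :: "complex \<Rightarrow> complex"
    and X :: "(complex \<Rightarrow> complex) set"
  assumes "\<psi> analytic_on \<D>"
    and "\<phi> analytic_on \<D>"
    and "\<phi> ` \<D> \<subseteq> \<D>"
    and "X \<subseteq> disk_analytic"
    and "automorphism_invariant X"
  shows
    "((\<forall>f\<in>X. comp_op \<phi> f \<in> X) \<and>
      (\<exists>f\<in>X. univalent f) \<and>
      (\<exists>f\<in>X. \<not> f constant_on \<D> \<and> extends_past_closed_disk f) \<and>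
      densely_nonextendable X
      \<longrightarrow> (invertible_on (comp_op \<phi>) X \<longleftrightarrow> disk_automorphism \<phi>)) \<and>
     ((\<forall>f\<in>X. weighted_comp_op \<psi> \<phi> f \<in> X) \<and>
      (\<exists>c. c \<noteq> 0 \<and> (\<lambda>z\<in>\<D>. c) \<in> X) \<and>
      (\<exists>c. (\<lambda>z\<in>\<D>. z + c) \<in> X) \<and>
      densely_nonextendable X
      \<longrightarrow> (invertible_on (weighted_comp_op \<psi> \<phi>) X \<longleftrightarrow>
           disk_automorphism \<phi> \<and> multiplier X \<psi> \<and> reciprocal_multiplier X \<psi>))"
proof (intro conjI impI; elim conjE exE bexE)
  fix u f
  assume "u \<in> X" "univalent u" "f \<in> X" "\<not> f constant_on \<D>" "extends_past_closed_disk f"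
    "densely_nonextendable X"
  then have "disk_automorphism \<phi>" if "comp_op \<phi> ` X = X"
    using comp_op_invertible_imp_automorphism[OF assms(2-4) that] by blast
  then show "invertible_on (comp_op \<phi>) X \<longleftrightarrow> disk_automorphism \<phi>"
    using comp_op_automorphism_bij[OF assms(4,5)]
    unfolding invertible_on_def bij_betw_def by blast
next
  fix c b
  assume hyp: "c \<noteq> 0" "(\<lambda>z\<in>\<D>. c) \<in> X" "(\<lambda>z\<in>\<D>. z + b) \<in> X" "densely_nonextendable X"
  show "invertible_on (weighted_comp_op \<psi> \<phi>) X \<longleftrightarrow>
    disk_automorphism \<phi> \<and> multiplier X \<psi> \<and> reciprocal_multiplier X \<psi>"
  proof
    assume inv: "invertible_on (weighted_comp_op \<psi> \<phi>) X"
    then have surj: "weighted_comp_op \<psi> \<phi> ` X = X"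
      by (simp add: invertible_on_def bij_betw_def)
    note auto = weighted_comp_op_invertible_imp_automorphism[OF assms(2-4) surj hyp]
    with inv weighted_comp_op_automorphism_bij_iff[OF assms(4,5) auto]
    show "disk_automorphism \<phi> \<and> multiplier X \<psi> \<and> reciprocal_multiplier X \<psi>"
      by (simp add: invertible_on_def reciprocal_multiplier_def)
  next
    assume "disk_automorphism \<phi> \<and> multiplier X \<psi> \<and> reciprocal_multiplier X \<psi>"
    then show "invertible_on (weighted_comp_op \<psi> \<phi>) X"
      using weighted_comp_op_automorphism_bij_iff[OF assms(4,5)]
      by (simp add: invertible_on_def reciprocal_multiplier_def)
  qed
qed

end
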